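(* Let $A,B\subseteq\mathbb{Z}$ with $\mathrm{BD}(A)=\alpha>0$ and $\mathrm{BD}(B)=\beta>0$. Then for every real $0\le\epsilon<\alpha^2\beta^2$, for every infinite $X\subseteq\mathbb{Z}$, and for every $x\in X$, there exists a finite subset $F\subset X$ such that (1) $x\in F$; (2) $|F|\le k$, where $k=\left\lfloor\frac{\alpha\beta-\epsilon}{\alpha^2\beta^2-\epsilon}\right\rfloor$; (3) $X\subseteq(\Delta_\epsilon(A)\cap\Delta_\epsilon(B))+F$. In consequence, for every integer $h$ the intersection $\Delta_\epsilon(A)/h\cap\Delta_\epsilon(B)/h$ is syndetic and its lower Banach density is not smaller than $1/k$.
   Context: $\mathbb{N}$ is the set of positive integers. For $A\subseteq\mathbb{Z}$, the upper Banach density is $\mathrm{BD}(A)=\lim_{n\to\infty}\max_{x\in\mathbb{Z}}\frac{|A\cap[x+1,x+n]|}{n}=\inf_{n\in\mathbb{N}}\max_{x\in\mathbb{Z}}\frac{|A\cap[x+1,x+n]|}{n}$ and the lower Banach density is $\underline{\mathrm{BD}}(A)=\lim_{n\to\infty}\min_{x\in\mathbb{Z}}\frac{|A\cap[x+1,x+n]|}{n}=\sup_{n\in\mathbb{N}}\min_{x\in\mathbb{Z}}\frac{|A\cap[x+1,x+n]|}{n}$. For real $\epsilon\ge0$, $\Delta_\epsilon(A)=\{t\in\mathbb{Z}\mid \mathrm{BD}(A\cap(A-t))>\epsilon\}$, where $A-t=\{a-t\mid a\in A\}$. For a set $S\subseteq\mathbb{Z}$ and an integer $h$, $S/h=\{x\in\mathbb{Z}\mid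 hx\in S\}$. Sumset: $S+F=\{s+f\mid s\in S,f\in F\}$. A set of integers is thick if it includes arbitrarily long finite intervals; it is syndetic if it has bounded gaps, i.e. its complement in $\mathbb{Z}$ is not thick. *)

theory Defs
  imports Complex_Main "HOL-Library.Set_Algebras"
begin

text \<open>
  For fixed \<open>n\<close> the counts \<open>card (A \<inter> {x+1..x+n})\<close> lie in \<open>{0..n}\<close>, so the maximum and the
  minimum over \<open>x\<close> are taken over a finite non-empty set. The maxima are subadditive and the minima
  superadditive in \<open>n\<close>, so by Fekete's lemma both limits exist and equal the infimum,
  respectively the supremum, over \<open>n \<ge> 1\<close>.
\<close>

definition upper_banach_density :: "int set \<Rightarrow> real" where
  "upper_banach_density A =
     lim (\<lambda>n::nat. Max (range (\<lambda>x::int. real (card (A \<inter> {x+1..x + int n})) / real n)))"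

definition lower_banach_density :: "int set \<Rightarrow> real" where
  "lower_banach_density A =
     lim (\<lambda>n::nat. Min (range (\<lambda>x::int. real (card (A \<inter> {x+1..x + int n})) / real n)))"

definition Delta :: "real \<Rightarrow> int set \<Rightarrow> int set" where
  "Delta \<epsilon> A = {t. upper_banach_density (A \<inter> (\<lambda>a. a - t) ` A) > \<epsilon>}"

definition set_quotient :: "int set \<Rightarrow> int \<Rightarrow> int set" where
  "set_quotient S h = {x. h * x \<in> S}"

definition thick :: "int set \<Rightarrow> bool" where
  "thick A \<longleftrightarrow> (\<forall>n::nat. \<exists>x. {x+1..x + int n} \<subseteq> A)"

definition syndetic :: "int set \<Rightarrow> bool" where
  "syndetic A \<longleftrightarrow> \<not> thick (- A)"

end

theory Submission
  imports Defs "HOL-Analysis.Convex"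
begin

text \<open>
  The heart of the matter is a bound on the size of a finite set \<open>F\<close> of integers no two of which
  differ by an element of \<open>D = Delta \<epsilon> A \<inter> Delta \<epsilon> B\<close>. Once every such \<open>F\<close> is known to have at most
  \<open>k\<close> elements, a largest one inside \<open>X\<close> containing \<open>x\<close> does the covering: \<open>D\<close> contains \<open>0\<close> and is
  symmetric, so an element of \<open>X\<close> outside \<open>D + F\<close> could be added to \<open>F\<close>
  (\<open>maximal_family_covers\<close>).

  The bound comes from treating \<open>A\<close> and \<open>B\<close> simultaneously. Put \<open>\<gamma> = \<alpha> * \<beta>\<close>. For every \<open>n\<close>, some
  translates of \<open>A\<close> and \<open>B\<close> have an intersection \<open>C\<close> with at least \<open>\<gamma> * n\<close> elements in \<open>{1..n}\<close>:
  fix a window of \<open>A\<close> with \<open>\<alpha> * n\<close> elements and slide it over a much longer rich window of \<open>B\<close>;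
  the average number of coincidences is about \<open>\<alpha> * \<beta> * n\<close> (\<open>exists_dense_alignment\<close>). Suppose
  \<open>m\<close> shifts of \<open>C\<close> are given by a set \<open>F\<close> as above. The overlap of two different shifts lies, up to
  translation, in both \<open>A \<inter> (A - d)\<close> and \<open>B \<inter> (B - d)\<close>, where \<open>d\<close> is the difference of the shifts;
  since \<open>d \<notin> D\<close>, one of these two sets has density at most \<open>\<epsilon>\<close>. The Cauchy--Schwarz inequality for
  the number of shifts of \<open>C\<close> covering a point then gives, as \<open>n\<close> grows,
  \<open>(m * \<gamma>)\<^sup>2 \<le> m * \<gamma> + m * (m - 1) * \<epsilon>\<close> (\<open>small_overlap_family_bound\<close>), which rearranges to
  \<open>m \<le> (\<gamma> - \<epsilon>) / (\<gamma>\<^sup>2 - \<epsilon>)\<close>.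

  For the quotients by \<open>h\<close>, take \<open>X\<close> to be the set of multiples of \<open>h\<close>. Dividing the covering by
  \<open>h\<close> shows that at most \<open>k\<close> translates of the quotient cover \<open>\<int>\<close>, and this forces lower
  Banach density at least \<open>1/k\<close> (\<open>lower_banach_density_of_translates_cover\<close>); a set of positive
  lower Banach density is syndetic.
\<close>

section \<open>Window counts and Banach density\<close>

definition max_count :: "int set \<Rightarrow> nat \<Rightarrow> nat" where
  "max_count A n = Max (range (\<lambda>x::int. card (A \<inter> {x+1..x + int n})))"

lemma card_window_le: "card (A \<inter> {x+1..x + int n}) \<le> n"
proof -
  have "card (A \<inter> {x+1..x + int n}) \<le> card {x+1..x + int n}"
    by (intro card_mono) auto
  then show ?thesis by simp
qed

lemma finite_range_window: "finite (range (\<lambda>x::int. card (A \<inter> {x+1..x + int n})))"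
  by (rule finite_subset[of _ "{..n}"]) (auto simp: card_window_le)

lemma window_le_max_count: "card (A \<inter> {x+1..x + int n}) \<le> max_count A n"
  unfolding max_count_def by (rule Max_ge[OF finite_range_window]) auto

lemma max_count_attained:
  obtains x where "card (A \<inter> {x+1..x + int n}) = max_count A n"
proof -
  have "max_count A n \<in> range (\<lambda>x::int. card (A \<inter> {x+1..x + int n}))"
    unfolding max_count_def by (rule Max_in[OF finite_range_window]) auto
  then show ?thesis using that by auto
qed

lemma max_count_le: "max_count A n \<le> n"
  by (metis max_count_attained card_window_le)

lemma max_count_add: "max_count A (m + n) \<le> max_count A m + max_count A n"
proof -
  obtain x where x: "card (A \<inter> {x+1..x + int (m+n)}) = max_count A (m+n)"
    by (rule max_count_attained)
  have "A \<inter> {x+1..x + int (m+n)} =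
      (A \<inter> {x+1..x + int m}) \<union> (A \<inter> {(x + int m)+1..(x + int m) + int n})"
    by auto
  then have "card (A \<inter> {x+1..x + int (m+n)}) \<le>
      card (A \<inter> {x+1..x + int m}) + card (A \<inter> {(x + int m)+1..(x + int m) + int n})"
    by (metis card_Un_le)
  then show ?thesis
    using window_le_max_count[of A x m] window_le_max_count[of A "x + int m" n] x by linarith
qed

lemma max_count_translate: "max_count ((\<lambda>a. a + t) ` A) n = max_count A n"
proof -
  have le: "max_count ((\<lambda>a. a + t) ` A) n \<le> max_count A n" for A t
  proof -
    obtain x where x: "card ((\<lambda>a. a + t) ` A \<inter> {x+1..x + int n}) = max_count ((\<lambda>a. a + t) ` A) n"
      by (rule max_count_attained)
    have "(\<lambda>a. a + t) ` A \<inter> {x+1..x + int n} = (\<lambda>a. a + t) ` (A \<inter> {(x-t)+1..(x-t) + int n})"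
      by auto
    then have "card ((\<lambda>a. a + t) ` A \<inter> {x+1..x + int n}) = card (A \<inter> {(x-t)+1..(x-t) + int n})"
      by (simp add: card_image inj_on_def)
    then show ?thesis using x window_le_max_count[of A "x-t" n] by simp
  qed
  have "(\<lambda>a. a + (- t)) ` (\<lambda>a. a + t) ` A = A" by (simp add: image_image)
  then show ?thesis using le[of t A] le[of "-t" "(\<lambda>a. a + t) ` A"] by simp
qed

text \<open>
  Fekete's lemma. Write \<open>n = d * q + r\<close> with \<open>r < q\<close>; subadditivity bounds \<open>u n\<close> by \<open>d * u q\<close> plus an
  error independent of \<open>n\<close>, so \<open>u n / n\<close> is eventually not much larger than any single \<open>u q / q\<close>.
\<close>

lemma Fekete_subadditive:
  fixes u :: "nat \<Rightarrow> real"
  assumes zero: "u 0 = 0" and nonneg: "\<And>n. u n \<ge> 0"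
    and sub: "\<And>m n. u (m + n) \<le> u m + u n"
  shows "(\<lambda>n. u n / real n) \<longlonglongrightarrow> (INF n\<in>{1..}. u n / real n)"
proof -
  let ?L = "INF n\<in>{1..}. u n / real n"
  have mult: "u (d * n) \<le> real d * u n" for d n
  proof (induction d)
    case (Suc d)
    then show ?case using sub[of n "d * n"] by (simp add: algebra_simps)
  qed (simp add: zero)
  have bdd: "bdd_below ((\<lambda>n. u n / real n) ` {1..})"
    by (rule bdd_belowI[of _ 0]) (auto simp: nonneg)
  have lower: "?L \<le> u n / real n" if "n \<ge> 1" for n
    by (rule cINF_lower[OF bdd]) (use that in auto)
  have bound: "u n / real n \<le> u q / real q + real q * u 1 / real n" if "q \<ge> 1" "n \<ge> 1" for q n
  proof -
    have "u n \<le> u (n div q * q) + u (n mod q)"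
      using sub[of "n div q * q" "n mod q"] by simp
    also have "\<dots> \<le> real (n div q) * u q + real (n mod q) * u 1"
      using mult[of "n div q" q] mult[of "n mod q" 1] by simp
    also have "\<dots> \<le> (real n / real q) * u q + real q * u 1"
      using that nonneg[of q] nonneg[of 1]
      by (intro add_mono mult_right_mono) (auto simp: of_nat_div_le_of_nat less_imp_le)
    finally show ?thesis using that by (simp add: field_simps)
  qed
  show ?thesis
  proof (rule order_tendstoI)
    fix a assume "a < ?L"
    then show "\<forall>\<^sub>F n in sequentially. a < u n / real n"
      using lower by (intro eventually_sequentiallyI[of 1]) (auto intro: less_le_trans)
  next
    fix a assume "?L < a"
    then obtain q where q: "q \<ge> 1" "u q / real q < a"
      using cINF_less_iff[OF _ bdd, of a] by auto
    have "(\<lambda>n. u q / real q + real q * u 1 * inverse (real n)) \<longlonglongrightarrow> u q / real q + real q * u 1 * 0"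
      by (intro tendsto_intros LIMSEQ_inverse_real_of_nat[THEN LIMSEQ_imp_Suc])
    then have "\<forall>\<^sub>F n in sequentially. u q / real q + real q * u 1 * inverse (real n) < a"
      using q(2) by (auto dest: order_tendstoD(2))
    then show "\<forall>\<^sub>F n in sequentially. u n / real n < a"
      using eventually_ge_at_top[of 1]
    proof eventually_elim
      case (elim n)
      then show ?case using bound[OF q(1), of n] by (simp add: divide_inverse)
    qed
  qed
qed

lemma Max_density_eq:
  "Max (range (\<lambda>x::int. real (card (A \<inter> {x+1..x + int n})) / real n)) = real (max_count A n) / real n"
proof -
  have "mono (\<lambda>c::nat. real c / real n)"
    by (auto simp: mono_def divide_right_mono)
  from mono_Max_commute[OF this finite_range_window[of A n]]
  show ?thesis by (simp add: max_count_def image_image)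
qed

text \<open>
  The two halves of Fekete's lemma are used in different roles. As an infimum, the density gives
  a window of every length that is at least as rich as the density demands; as a limit, it says
  that the windows of a set of density at most \<open>\<epsilon>\<close> eventually contain little more than a
  proportion \<open>\<epsilon>\<close>.
\<close>

lemma upper_banach_density_props:
  shows upper_banach_density_LIMSEQ:
      "(\<lambda>n. real (max_count A n) / real n) \<longlonglongrightarrow> upper_banach_density A" (is ?lim)
    and upper_banach_density_le: "n \<ge> 1 \<Longrightarrow> upper_banach_density A \<le> real (max_count A n) / real n"
proof -
  have "max_count A 0 = 0" using max_count_le[of A 0] by simp
  then have *: "(\<lambda>n. real (max_count A n) / real n) \<longlonglongrightarrow> (INF n\<in>{1..}. real (max_count A n) / real n)"
    using max_count_add[of A] by (intro Fekete_subadditive) (auto simp flip: of_nat_add)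
  then have eq: "upper_banach_density A = (INF n\<in>{1..}. real (max_count A n) / real n)"
    unfolding upper_banach_density_def Max_density_eq by (rule limI)
  show ?lim using * eq by simp
  show "upper_banach_density A \<le> real (max_count A n) / real n" if "n \<ge> 1"
    unfolding eq by (rule cINF_lower) (use that in \<open>auto intro!: bdd_belowI[of _ 0]\<close>)
qed

lemma upper_banach_density_le_one: "upper_banach_density A \<le> 1"
  using upper_banach_density_le[of 1 A] max_count_le[of A 1] by simp

lemma upper_banach_density_translate:
  "upper_banach_density ((\<lambda>a. a + t) ` A) = upper_banach_density A"
  unfolding upper_banach_density_def Max_density_eq max_count_translate ..

lemma card_window_compl:
  "card (A \<inter> {x+1..x + int n}) = n - card (- A \<inter> {x+1..x + int n})"
proof -
  have "card (A \<inter> {x+1..x + int n}) + card (- A \<inter> {x+1..x + int n}) = card {x+1..x + int n}"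
    by (subst card_Un_disjoint[symmetric]) (auto simp flip: Int_Un_distrib2)
  then show ?thesis by simp
qed

text \<open>
  Passing to complements turns minima into maxima, so that the existence of the limit defining
  the lower density is inherited from the upper one.
\<close>

lemma lower_banach_density_eq: "lower_banach_density A = 1 - upper_banach_density (- A)"
proof -
  have "Min (range (\<lambda>x::int. real (card (A \<inter> {x+1..x + int n})) / real n)) =
      1 - real (max_count (- A) n) / real n" if "n \<ge> 1" for n
  proof -
    let ?f = "\<lambda>x::int. real (card (A \<inter> {x+1..x + int n})) / real n"
    have f: "?f x = 1 - real (card (- A \<inter> {x+1..x + int n})) / real n" for x
      using that card_window_le[of "-A" x n]
      by (simp add: card_window_compl[of A] of_nat_diff diff_divide_distrib)
    show ?thesis
    proof (rule Min_eqI)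
      have "range ?f = (\<lambda>c. real c / real n) ` range (\<lambda>x::int. card (A \<inter> {x+1..x + int n}))"
        by (simp add: image_image)
      then show "finite (range ?f)" using finite_range_window[of A n] by simp
      show "1 - real (max_count (- A) n) / real n \<le> y" if "y \<in> range ?f" for y
        using that window_le_max_count[of "-A" _ n] unfolding f
        by (auto intro!: divide_right_mono)
      obtain x where x: "card (- A \<inter> {x+1..x + int n}) = max_count (- A) n"
        by (rule max_count_attained)
      show "1 - real (max_count (- A) n) / real n \<in> range ?f"
        by (rule range_eqI[of _ _ x]) (use f[of x] x in simp)
    qed
  qed
  moreover have "(\<lambda>n. 1 - real (max_count (- A) n) / real n) \<longlonglongrightarrow> 1 - upper_banach_density (- A)"
    by (intro tendsto_intros upper_banach_density_LIMSEQ)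
  ultimately have "(\<lambda>n. Min (range (\<lambda>x::int. real (card (A \<inter> {x+1..x + int n})) / real n)))
      \<longlonglongrightarrow> 1 - upper_banach_density (- A)"
    by (subst tendsto_cong[where g = "\<lambda>n. 1 - real (max_count (- A) n) / real n"])
      (auto intro!: eventually_sequentiallyI[of 1])
  then show ?thesis unfolding lower_banach_density_def by (rule limI)
qed

lemma syndetic_of_lower_banach_density_pos:
  assumes "lower_banach_density S > 0"
  shows "syndetic S"
proof (rule ccontr)
  assume "\<not> syndetic S"
  then have thick: "\<exists>x. {x+1..x + int n} \<subseteq> - S" for n
    unfolding syndetic_def thick_def by blast
  have "max_count (- S) n = n" for n
  proof -
    obtain x where "{x+1..x + int n} \<subseteq> - S" using thick by blast
    then have "- S \<inter> {x+1..x + int n} = {x+1..x + int n}" by blast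
    then show ?thesis
      using window_le_max_count[of "- S" x n] max_count_le[of "- S" n] by simp
  qed
  then have "(\<lambda>n. real n / real n) \<longlonglongrightarrow> upper_banach_density (- S)"
    using upper_banach_density_LIMSEQ[of "- S"] by simp
  moreover have "(\<lambda>n. real n / real n) \<longlonglongrightarrow> 1"
    by (subst tendsto_cong[where g = "\<lambda>n. 1"]) (auto intro!: eventually_sequentiallyI[of 1])
  ultimately have "upper_banach_density (- S) = 1" by (rule LIMSEQ_unique)
  then show False using assms by (simp add: lower_banach_density_eq)
qed

text \<open>
  Moving a window by \<open>t\<close> loses only the at most \<open>\<bar>t\<bar>\<close> points that leave it, a quantity independent of
  the length \<open>n\<close> and hence invisible to densities.
\<close>

lemma card_window_shift:
  "card (A \<inter> {x+1..x + int n}) \<le> card (A \<inter> {x+t+1..x+t + int n}) + nat \<bar>t\<bar>"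
proof -
  let ?E = "if t \<ge> 0 then {x+1..x+t} else {x+t+int n+1..x + int n}"
  have "A \<inter> {x+1..x + int n} \<subseteq> (A \<inter> {x+t+1..x+t + int n}) \<union> ?E"
    by auto
  then have "card (A \<inter> {x+1..x + int n}) \<le> card ((A \<inter> {x+t+1..x+t + int n}) \<union> ?E)"
    by (intro card_mono) auto
  also have "\<dots> \<le> card (A \<inter> {x+t+1..x+t + int n}) + card ?E"
    by (rule card_Un_le)
  also have "card ?E = nat \<bar>t\<bar>" by auto
  finally show ?thesis .
qed

text \<open>
  Each window of length \<open>n\<close> is covered by the translates of \<open>S\<close>, and each translate contributes, up to
  a bounded error, the number of points of \<open>S\<close> in the same window.
\<close>

lemma lower_banach_density_of_translates_cover:
  fixes S F :: "int set"
  assumes "finite F" and cover: "S + F = UNIV"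
  shows "lower_banach_density S \<ge> 1 / real (card F)"
proof -
  let ?K = "\<Sum>f\<in>F. real (nat \<bar>f\<bar>)"
  have "F \<noteq> {}" using cover by auto
  then have m: "real (card F) > 0" using \<open>finite F\<close> by (simp add: card_gt_0_iff)
  have count: "real n \<le> real (card F) * real (card (S \<inter> {x+1..x + int n})) + ?K" for x n
  proof -
    have "{x+1..x + int n} \<subseteq> (\<Union>f\<in>F. (\<lambda>s. s + f) ` (S \<inter> {x-f+1..x-f + int n}))"
    proof
      fix z assume z: "z \<in> {x+1..x + int n}"
      have "z \<in> S + F" using cover by simp
      then obtain s f where "s \<in> S" "f \<in> F" "z = s + f" by (auto elim: set_plus_elim)
      then show "z \<in> (\<Union>f\<in>F. (\<lambda>s. s + f) ` (S \<inter> {x-f+1..x-f + int n}))"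
        using z by (intro UN_I[of f] image_eqI[of _ _ s]) auto
    qed
    then have "card {x+1..x + int n} \<le> card (\<Union>f\<in>F. (\<lambda>s. s + f) ` (S \<inter> {x-f+1..x-f + int n}))"
      using \<open>finite F\<close> by (intro card_mono) auto
    also have "\<dots> \<le> (\<Sum>f\<in>F. card ((\<lambda>s. s + f) ` (S \<inter> {x-f+1..x-f + int n})))"
      using \<open>finite F\<close> by (rule card_UN_le)
    also have "\<dots> \<le> (\<Sum>f\<in>F. card (S \<inter> {x+1..x + int n}) + nat \<bar>f\<bar>)"
    proof (rule sum_mono)
      fix f
      have "card ((\<lambda>s. s + f) ` (S \<inter> {x-f+1..x-f + int n})) = card (S \<inter> {x-f+1..x-f + int n})"
        by (intro card_image) (simp add: inj_on_def)
      then show "card ((\<lambda>s. s + f) ` (S \<inter> {x-f+1..x-f + int n}))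
          \<le> card (S \<inter> {x+1..x + int n}) + nat \<bar>f\<bar>"
        using card_window_shift[of S "x-f" n f] by simp
    qed
    finally have "n \<le> card F * card (S \<inter> {x+1..x + int n}) + (\<Sum>f\<in>F. nat \<bar>f\<bar>)"
      by (simp add: sum.distrib)
    then have "real n \<le> real (card F * card (S \<inter> {x+1..x + int n}) + (\<Sum>f\<in>F. nat \<bar>f\<bar>))"
      by (simp only: of_nat_le_iff)
    then show ?thesis by simp
  qed
  have "real (max_count (- S) n) / real n \<le> 1 - 1 / real (card F) + ?K / real (card F) * inverse (real n)"
    if "n \<ge> 1" for n
  proof -
    obtain x where x: "card (- S \<inter> {x+1..x + int n}) = max_count (- S) n"
      by (rule max_count_attained)
    have "card (S \<inter> {x+1..x + int n}) = n - max_count (- S) n"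
      using card_window_compl[of S x n] x by simp
    then have "real n \<le> real (card F) * (real n - real (max_count (- S) n)) + ?K"
      using count[of n x] max_count_le[of "-S" n] by (simp add: of_nat_diff)
    then have "real (card F) * real (max_count (- S) n) / (real (card F) * real n)
        \<le> (real (card F) * real n - real n + ?K) / (real (card F) * real n)"
      by (intro divide_right_mono) (simp_all add: algebra_simps)
    also have "\<dots> = 1 - 1 / real (card F) + ?K / real (card F) * inverse (real n)"
      using m that by (simp add: field_simps)
    finally show ?thesis using m by simp
  qed
  moreover have "(\<lambda>n. 1 - 1 / real (card F) + ?K / real (card F) * inverse (real n))
      \<longlonglongrightarrow> 1 - 1 / real (card F) + ?K / real (card F) * 0"
    by (intro tendsto_intros LIMSEQ_inverse_real_of_nat[THEN LIMSEQ_imp_Suc])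
  ultimately have "upper_banach_density (- S) \<le> 1 - 1 / real (card F) + ?K / real (card F) * 0"
    by (intro LIMSEQ_le[OF upper_banach_density_LIMSEQ]) auto
  then show ?thesis by (simp add: lower_banach_density_eq)
qed

section \<open>Aligning two sets\<close>

text \<open>
  Let \<open>P\<close> be a rich window of \<open>A\<close> of length \<open>n\<close> and \<open>Q\<close> a rich window of \<open>B\<close> of length \<open>N\<close>. Each pair in
  \<open>P \<times> Q\<close> is matched by exactly one of \<open>N + n\<close> shifts of \<open>P\<close>, so some shift has at least
  \<open>\<alpha> * n * \<beta> * N / (N + n)\<close> coincidences. The best shift of \<open>P\<close> against the whole of \<open>B\<close> beats this for
  every \<open>N\<close>; hence letting \<open>N\<close> tend to infinity leaves no error term in the result.
\<close>

lemma exists_dense_alignment: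
  fixes A B :: "int set"
  assumes a: "0 \<le> upper_banach_density A" and b: "0 \<le> upper_banach_density B"
  shows "\<exists>x y. upper_banach_density A * upper_banach_density B * real n
      \<le> real (card ({i. x + i \<in> A \<and> y + i \<in> B} \<inter> {1..int n}))"
proof (cases "n = 0")
  case False
  let ?\<alpha> = "upper_banach_density A" and ?\<beta> = "upper_banach_density B"
  obtain x where x: "card (A \<inter> {x+1..x + int n}) = max_count A n"
    by (rule max_count_attained)
  define P where "P = {i. x + i \<in> A} \<inter> {1..int n}"
  have finP: "finite P" unfolding P_def by simp
  have "(\<lambda>i. x + i) ` P = A \<inter> {x+1..x + int n}"
  proof
    show "A \<inter> {x+1..x + int n} \<subseteq> (\<lambda>i. x + i) ` P"
    proof
      fix z assume "z \<in> A \<inter> {x+1..x + int n}"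
      then show "z \<in> (\<lambda>i. x + i) ` P"
        by (intro image_eqI[of _ _ "z - x"]) (auto simp: P_def)
    qed
  qed (auto simp: P_def)
  then have "card P = max_count A n"
    using x card_image[of "\<lambda>i. x + i" P] by (simp add: inj_on_def)
  then have P: "real (card P) \<ge> ?\<alpha> * real n"
    using upper_banach_density_le[of n A] False by (simp add: field_simps)
  define c where "c y = card {i\<in>P. y + i \<in> B}" for y
  have "c y < Suc (card P)" for y
    unfolding c_def using finP by (simp add: less_Suc_eq_le card_mono)
  then obtain y where y: "\<And>y'. c y' \<le> c y"
    using ex_has_greatest_nat[of "\<lambda>_. True" 0 c "Suc (card P)"] by blast
  have main: "?\<alpha> * ?\<beta> * real n \<le> real (c y) + real (c y) * real n * inverse (real N)"
    if "N \<ge> 1" for N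
  proof -
    obtain z where z: "card (B \<inter> {z+1..z + int N}) = max_count B N"
      by (rule max_count_attained)
    define Q where "Q = B \<inter> {z+1..z + int N}"
    define T where "T = {z+1-int n..z + int N}"
    have Q: "real (card Q) \<ge> ?\<beta> * real N"
      using upper_banach_density_le[of N B] that z by (simp add: Q_def field_simps)
    have fib: "card Q \<le> card {s\<in>T. s + i \<in> Q}" if "i \<in> P" for i
    proof -
      have "(\<lambda>q. q - i) ` Q \<subseteq> {s\<in>T. s + i \<in> Q}"
        using that by (auto simp: P_def Q_def T_def)
      then have "card ((\<lambda>q. q - i) ` Q) \<le> card {s\<in>T. s + i \<in> Q}"
        by (rule card_mono[rotated]) (rule finite_subset[of _ T], auto simp: T_def)
      then show ?thesis by (simp add: card_image inj_on_def)
    qed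
    have "card P * card Q \<le> (\<Sum>i\<in>P. card {s\<in>T. s + i \<in> Q})"
      using sum_mono[OF fib, of P "\<lambda>i. i"] by simp
    also have "\<dots> = (\<Sum>i\<in>P. \<Sum>s\<in>T. of_bool (s + i \<in> Q))"
      by (simp add: T_def Int_def)
    also have "\<dots> = (\<Sum>s\<in>T. \<Sum>i\<in>P. of_bool (s + i \<in> Q))"
      by (rule sum.swap)
    also have "\<dots> \<le> (\<Sum>s\<in>T. c s)"
    proof (rule sum_mono)
      fix s
      have "(\<Sum>i\<in>P. of_bool (s + i \<in> Q)) = card {i\<in>P. s + i \<in> Q}"
        using finP by (simp add: Int_def)
      also have "\<dots> \<le> c s"
        unfolding c_def using finP by (intro card_mono) (auto simp: Q_def)
      finally show "(\<Sum>i\<in>P. of_bool (s + i \<in> Q)) \<le> c s" .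
    qed
    also have "\<dots> \<le> (\<Sum>s\<in>T. c y)" by (intro sum_mono y)
    also have "\<dots> = (N + n) * c y" by (simp add: T_def nat_add_distrib)
    finally have "card P * card Q \<le> (N + n) * c y" .
    then have "real (card P) * real (card Q) \<le> (real N + real n) * real (c y)"
      by (metis of_nat_add of_nat_le_iff of_nat_mult)
    moreover have "(?\<alpha> * real n) * (?\<beta> * real N) \<le> real (card P) * real (card Q)"
      using P Q a b by (intro mult_mono) auto
    ultimately have "(?\<alpha> * ?\<beta> * real n) * real N \<le> (real N + real n) * real (c y)"
      by (simp add: mult_ac)
    then show ?thesis using that by (simp add: field_simps)
  qed
  have "(\<lambda>N. real (c y) + real (c y) * real n * inverse (real N))
      \<longlonglongrightarrow> real (c y) + real (c y) * real n * 0"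
    by (intro tendsto_intros LIMSEQ_inverse_real_of_nat[THEN LIMSEQ_imp_Suc])
  then have "?\<alpha> * ?\<beta> * real n \<le> real (c y) + real (c y) * real n * 0"
    using main by (intro LIMSEQ_le_const) auto
  moreover have "{i\<in>P. y + i \<in> B} = {i. x + i \<in> A \<and> y + i \<in> B} \<inter> {1..int n}"
    by (auto simp: P_def)
  ultimately show ?thesis by (intro exI[of _ x] exI[of _ y]) (simp add: c_def)
qed simp

section \<open>Families of shifts with small overlaps\<close>

text \<open>
  Here \<open>S\<close> is the sum over the window of \<open>f i\<close>, the number of shifts of \<open>C\<close> that cover \<open>i\<close>. The sum of
  the squares of \<open>f\<close> counts common points of pairs of shifts, and the diagonal pairs
  contribute \<open>S\<close> itself. The estimate is then the Cauchy--Schwarz inequality.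
\<close>

lemma square_sum_shifts_le:
  fixes C :: "int set" and F :: "int set" and n :: nat
  assumes "finite F"
  defines "S \<equiv> (\<Sum>t\<in>F. real (card {i\<in>{1..int n}. i + t \<in> C}))"
  shows "S\<^sup>2 \<le> real n * (S + (\<Sum>t\<in>F. \<Sum>u\<in>F - {t}.
            real (card {i\<in>{1..int n}. i + t \<in> C \<and> i + u \<in> C})))"
proof -
  let ?I = "{1..int n}"
  define f where "f i = (\<Sum>t\<in>F. of_bool (i + t \<in> C) :: real)" for i
  have S: "S = (\<Sum>i\<in>?I. f i)"
    unfolding S_def f_def by (subst sum.swap) (simp add: Int_def)
  have sq: "(f i)\<^sup>2 = (\<Sum>t\<in>F. \<Sum>u\<in>F. of_bool (i + t \<in> C \<and> i + u \<in> C))" for i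
    by (simp add: f_def power2_eq_square sum_product of_bool_conj)
  have "(\<Sum>i\<in>?I. (f i)\<^sup>2) = (\<Sum>t\<in>F. \<Sum>u\<in>F. \<Sum>i\<in>?I. of_bool (i + t \<in> C \<and> i + u \<in> C))"
    unfolding sq by (subst sum.swap, rule sum.cong[OF refl], rule sum.swap)
  also have "\<dots> = (\<Sum>t\<in>F. \<Sum>u\<in>F. real (card {i\<in>?I. i + t \<in> C \<and> i + u \<in> C}))"
    by (simp add: Int_def)
  also have "\<dots> = S + (\<Sum>t\<in>F. \<Sum>u\<in>F - {t}. real (card {i\<in>?I. i + t \<in> C \<and> i + u \<in> C}))"
    unfolding S_def sum.distrib[symmetric]
    using \<open>finite F\<close> by (intro sum.cong) (auto simp: sum.remove)
  finally have sum_sq: "(\<Sum>i\<in>?I. (f i)\<^sup>2) =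
      S + (\<Sum>t\<in>F. \<Sum>u\<in>F - {t}. real (card {i\<in>?I. i + t \<in> C \<and> i + u \<in> C}))" .
  have "S\<^sup>2 \<le> real n * (\<Sum>i\<in>?I. (f i)\<^sup>2)"
    using sum_squared_le_sum_of_squares[of f ?I] by (simp add: S mult.commute)
  then show ?thesis by (simp add: sum_sq)
qed

text \<open>
  To be applied with \<open>C\<close> an intersection of translates of \<open>A\<close> and \<open>B\<close>: overlaps of its shifts are
  controlled through whichever of the two sets has few pairs of points at distance \<open>u - t\<close>.
\<close>

lemma card_common_shift_le:
  assumes "\<And>i. i \<in> C \<Longrightarrow> x + i \<in> A"
  shows "card {i\<in>{1..int n}. i + t \<in> C \<and> i + u \<in> C} \<le> max_count (A \<inter> (\<lambda>a. a - (u - t)) ` A) n"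
proof -
  let ?J = "{i\<in>{1..int n}. i + t \<in> C \<and> i + u \<in> C}" and ?E = "A \<inter> (\<lambda>a. a - (u - t)) ` A"
  have "(\<lambda>i. x + t + i) ` ?J \<subseteq> ?E \<inter> {(x+t)+1..(x+t) + int n}"
  proof (rule image_subsetI)
    fix i assume i: "i \<in> ?J"
    then have "x + (i + t) \<in> A" "x + (i + u) \<in> A" using assms by blast+
    then show "x + t + i \<in> ?E \<inter> {(x+t)+1..(x+t) + int n}"
      using i by (auto simp: algebra_simps intro!: image_eqI[of _ _ "x + (i + u)"])
  qed
  then have "card ((\<lambda>i. x + t + i) ` ?J) \<le> card (?E \<inter> {(x+t)+1..(x+t) + int n})"
    by (intro card_mono) auto
  also have "\<dots> \<le> max_count ?E n" by (rule window_le_max_count)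
  finally show ?thesis by (simp add: card_image inj_on_def)
qed

text \<open>
  With \<open>m = card F\<close>, the average number \<open>\<sigma>\<close> of shifts covering a point of the window satisfies
  \<open>\<sigma>\<^sup>2 - \<sigma> \<le> m * (m - 1) * \<epsilon>\<close> in the limit, while \<open>\<sigma>\<close> is asymptotically at least \<open>m * \<gamma>\<close>. Replacing
  \<open>\<sigma>\<close> by this lower bound is legitimate where \<open>\<sigma>\<^sup>2 - \<sigma>\<close> increases, that is beyond \<open>1/2\<close>; if
  \<open>m * \<gamma> < 1\<close>, then \<open>(m * \<gamma>)\<^sup>2 \<le> m * \<gamma>\<close> and the claim is clear.
\<close>

lemma small_overlap_family_bound:
  fixes A B F :: "int set" and \<epsilon> :: real
  defines "\<gamma> \<equiv> upper_banach_density A * upper_banach_density B"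
  assumes a: "0 \<le> upper_banach_density A" and b: "0 \<le> upper_banach_density B"
    and "0 \<le> \<epsilon>" and "finite F"
    and small: "\<And>t u. t \<in> F \<Longrightarrow> u \<in> F \<Longrightarrow> t \<noteq> u \<Longrightarrow> u - t \<notin> Delta \<epsilon> A \<inter> Delta \<epsilon> B"
  shows "(real (card F) * \<gamma>)\<^sup>2 \<le> real (card F) * \<gamma> + real (card F) * (real (card F) - 1) * \<epsilon>"
proof (cases "real (card F) * \<gamma> < 1")
  case True
  have "0 \<le> real (card F) * \<gamma>" using a b by (simp add: \<gamma>_def)
  then have "(real (card F) * \<gamma>)\<^sup>2 \<le> real (card F) * \<gamma>"
    using True by (simp add: power2_eq_square mult_left_le)
  moreover have "0 \<le> real (card F) * (real (card F) - 1) * \<epsilon>"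
    using \<open>0 \<le> \<epsilon>\<close> by (cases "card F = 0") auto
  ultimately show ?thesis by linarith
next
  case False
  define s where "s = real (card F) * \<gamma>"
  define K where "K = (\<Sum>t\<in>F. real (nat \<bar>t\<bar>))"
  \<comment> \<open>whichever of the two self-intersections at distance \<open>u - t\<close> has density at most \<open>\<epsilon>\<close>\<close>
  define E where "E t u = (if upper_banach_density (A \<inter> (\<lambda>a. a - (u - t)) ` A) \<le> \<epsilon>
      then A \<inter> (\<lambda>a. a - (u - t)) ` A else B \<inter> (\<lambda>b. b - (u - t)) ` B)" for t u
  define e where "e n = (\<Sum>t\<in>F. \<Sum>u\<in>F - {t}. real (max_count (E t u) n) / real n)" for n
  \<comment> \<open>the lower bound for the average number of shifts covering a point of \<open>{1..n}\<close>\<close>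
  define r where "r n = s - K * inverse (real n)" for n
  have E: "upper_banach_density (E t u) \<le> \<epsilon>" if "t \<in> F" "u \<in> F - {t}" for t u
    using small[of t u] that by (auto simp: E_def Delta_def)
  have e_lim: "e \<longlonglongrightarrow> (\<Sum>t\<in>F. \<Sum>u\<in>F - {t}. upper_banach_density (E t u))"
    unfolding e_def by (intro tendsto_sum upper_banach_density_LIMSEQ)
  have r_lim: "r \<longlonglongrightarrow> s - K * 0"
    unfolding r_def by (intro tendsto_intros LIMSEQ_inverse_real_of_nat[THEN LIMSEQ_imp_Suc])
  have key: "(r n)\<^sup>2 - r n \<le> e n" if n: "n \<ge> 1" and rn: "r n > 1/2" for n
  proof -
    obtain x y where xy: "\<gamma> * real n \<le> real (card ({i. x + i \<in> A \<and> y + i \<in> B} \<inter> {1..int n}))"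
      using exists_dense_alignment[OF a b, of n] unfolding \<gamma>_def by blast
    define C where "C = {i. x + i \<in> A \<and> y + i \<in> B}"
    define S where "S = (\<Sum>t\<in>F. real (card {i\<in>{1..int n}. i + t \<in> C}))"
    have shift: "\<gamma> * real n - real (nat \<bar>t\<bar>) \<le> real (card {i\<in>{1..int n}. i + t \<in> C})" for t
    proof -
      have "(\<lambda>i. i + t) ` {i\<in>{1..int n}. i + t \<in> C} = C \<inter> {0+t+1..0+t + int n}"
      proof
        show "C \<inter> {0+t+1..0+t + int n} \<subseteq> (\<lambda>i. i + t) ` {i\<in>{1..int n}. i + t \<in> C}"
        proof
          fix z assume "z \<in> C \<inter> {0+t+1..0+t + int n}"
          then show "z \<in> (\<lambda>i. i + t) ` {i\<in>{1..int n}. i + t \<in> C}"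
            by (intro image_eqI[of _ _ "z - t"]) auto
        qed
      qed auto
      then have "card (C \<inter> {0+t+1..0+t + int n}) = card {i\<in>{1..int n}. i + t \<in> C}"
        using card_image[of "\<lambda>i. i + t" "{i\<in>{1..int n}. i + t \<in> C}"] by (simp add: inj_on_def)
      then show ?thesis
        using card_window_shift[of C 0 n t] xy unfolding C_def[symmetric] by simp
    qed
    have "(\<Sum>t\<in>F. \<gamma> * real n - real (nat \<bar>t\<bar>)) \<le> S"
      unfolding S_def by (intro sum_mono shift)
    then have "s * real n - K \<le> S" by (simp add: sum_subtractf K_def s_def mult_ac)
    then have "(s * real n - K) / real n \<le> S / real n" by (simp add: divide_right_mono)
    moreover have "r n = (s * real n - K) / real n" using n by (simp add: r_def field_simps)
    ultimately have r_le: "r n \<le> S / real n" by simp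
    have overlap: "real (card {i\<in>{1..int n}. i + t \<in> C \<and> i + u \<in> C}) \<le> real (max_count (E t u) n)" for t u
      using card_common_shift_le[of C x A n t u] card_common_shift_le[of C y B n t u]
      by (auto simp: E_def C_def)
    have "S\<^sup>2 \<le> real n * (S + (\<Sum>t\<in>F. \<Sum>u\<in>F - {t}. real (card {i\<in>{1..int n}. i + t \<in> C \<and> i + u \<in> C})))"
      unfolding S_def by (rule square_sum_shifts_le[OF \<open>finite F\<close>])
    also have "\<dots> \<le> real n * (S + (\<Sum>t\<in>F. \<Sum>u\<in>F - {t}. real (max_count (E t u) n)))"
      by (intro mult_left_mono add_left_mono sum_mono overlap) auto
    also have "\<dots> = real n * (S + real n * e n)"
      using n by (simp add: e_def sum_distrib_left)
    finally have "(S / real n)\<^sup>2 - S / real n \<le> e n"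
      using n by (simp add: field_simps power2_eq_square)
    moreover have "(r n)\<^sup>2 - r n \<le> (S / real n)\<^sup>2 - S / real n"
    proof -
      have "0 \<le> (S / real n - r n) * (S / real n + r n - 1)"
        using r_le rn by (intro mult_nonneg_nonneg) auto
      then show ?thesis by (simp add: algebra_simps power2_eq_square)
    qed
    ultimately show ?thesis by linarith
  qed
  have "\<forall>\<^sub>F n in sequentially. r n > 1/2"
    using r_lim False by (intro order_tendstoD(1)[OF r_lim]) (simp add: s_def)
  then have "\<forall>\<^sub>F n in sequentially. (r n)\<^sup>2 - r n \<le> e n"
    using eventually_ge_at_top[of 1] by eventually_elim (rule key)
  moreover have "(\<lambda>n. (r n)\<^sup>2 - r n) \<longlonglongrightarrow> (s - K * 0)\<^sup>2 - (s - K * 0)"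
    by (intro tendsto_intros r_lim)
  ultimately have "(s - K * 0)\<^sup>2 - (s - K * 0) \<le> (\<Sum>t\<in>F. \<Sum>u\<in>F - {t}. upper_banach_density (E t u))"
    using tendsto_le[OF _ e_lim] by auto
  also have "\<dots> \<le> (\<Sum>t\<in>F. \<Sum>u\<in>F - {t}. \<epsilon>)"
    by (intro sum_mono E)
  also have "\<dots> = real (card F) * (real (card F) - 1) * \<epsilon>"
    using \<open>finite F\<close> by (cases "F = {}") (auto simp: of_nat_diff card_gt_0_iff Suc_le_eq)
  finally show ?thesis by (simp add: s_def)
qed

section \<open>Covering by maximal families\<close>

lemma Delta_uminus: "- t \<in> Delta \<epsilon> A \<longleftrightarrow> t \<in> Delta \<epsilon> A"
proof -
  have "(\<lambda>a. a + t) ` (A \<inter> (\<lambda>a. a - t) ` A) = A \<inter> (\<lambda>a. a - - t) ` A"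
    by (force simp: image_iff)
  then show ?thesis
    unfolding Delta_def by (simp flip: upper_banach_density_translate[of t "A \<inter> (\<lambda>a. a - t) ` A"])
qed

lemma small_overlap_card_le:
  fixes A B F :: "int set" and \<alpha> \<beta> \<epsilon> :: real
  assumes \<alpha>: "upper_banach_density A = \<alpha>" "\<alpha> > 0" and \<beta>: "upper_banach_density B = \<beta>" "\<beta> > 0"
    and \<epsilon>: "0 \<le> \<epsilon>" "\<epsilon> < \<alpha>\<^sup>2 * \<beta>\<^sup>2"
    and "finite F"
    and small: "\<And>t u. t \<in> F \<Longrightarrow> u \<in> F \<Longrightarrow> t \<noteq> u \<Longrightarrow> u - t \<notin> Delta \<epsilon> A \<inter> Delta \<epsilon> B"
  shows "int (card F) \<le> \<lfloor>(\<alpha> * \<beta> - \<epsilon>) / (\<alpha>\<^sup>2 * \<beta>\<^sup>2 - \<epsilon>)\<rfloor>"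
proof -
  define m where "m = real (card F)"
  define \<gamma> where "\<gamma> = \<alpha> * \<beta>"
  have \<gamma>: "\<gamma> > 0" "\<gamma> \<le> 1"
    using \<alpha> \<beta> upper_banach_density_le_one[of A] upper_banach_density_le_one[of B]
    by (auto simp: \<gamma>_def mult_le_one)
  have \<epsilon>': "\<epsilon> < \<gamma>\<^sup>2" using \<epsilon> by (simp add: \<gamma>_def power_mult_distrib)
  have "(m * \<gamma>)\<^sup>2 \<le> m * \<gamma> + m * (m - 1) * \<epsilon>"
    using small_overlap_family_bound[of A B \<epsilon> F] small \<alpha> \<beta> \<epsilon> \<open>finite F\<close>
    by (simp add: m_def \<gamma>_def)
  then have "m * (m * (\<gamma>\<^sup>2 - \<epsilon>)) \<le> m * (\<gamma> - \<epsilon>)"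
    by (simp add: algebra_simps power2_eq_square)
  moreover have "\<gamma>\<^sup>2 \<le> \<gamma>" using \<gamma> by (simp add: power2_eq_square mult_left_le)
  \<comment> \<open>for nonempty \<open>F\<close> cancel \<open>m\<close>; for empty \<open>F\<close> the claim is \<open>\<epsilon> \<le> \<gamma>\<close>\<close>
  ultimately have "m * (\<gamma>\<^sup>2 - \<epsilon>) \<le> \<gamma> - \<epsilon>"
    using \<epsilon>' by (cases "card F = 0") (auto simp: m_def)
  then have "m \<le> (\<gamma> - \<epsilon>) / (\<gamma>\<^sup>2 - \<epsilon>)"
    using \<epsilon>' by (simp add: pos_le_divide_eq)
  then show ?thesis by (simp add: le_floor_iff m_def \<gamma>_def power_mult_distrib)
qed

text \<open>
  A family of largest size exists because sizes are bounded by \<open>k\<close>, and being largest it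
  cannot be extended by any \<open>y \<in> X\<close>: some \<open>f \<in> F\<close> has \<open>y - f \<in> D\<close> or \<open>f - y \<in> D\<close>, which is the same by
  symmetry.
\<close>

lemma maximal_family_covers:
  fixes D X :: "int set"
  assumes zero: "0 \<in> D" and sym: "\<And>t. - t \<in> D \<longleftrightarrow> t \<in> D" and "x \<in> X"
    and bound: "\<And>F. finite F \<Longrightarrow> (\<And>t u. t \<in> F \<Longrightarrow> u \<in> F \<Longrightarrow> t \<noteq> u \<Longrightarrow> u - t \<notin> D) \<Longrightarrow> int (card F) \<le> k"
  shows "\<exists>F. finite F \<and> F \<subseteq> X \<and> x \<in> F \<and> int (card F) \<le> k \<and> X \<subseteq> D + F"
proof -
  define good where "good F \<longleftrightarrow> finite F \<and> F \<subseteq> X \<and> x \<in> F \<and>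
      (\<forall>t\<in>F. \<forall>u\<in>F. t \<noteq> u \<longrightarrow> u - t \<notin> D)" for F
  have card_le: "int (card F) \<le> k" if "good F" for F
    using that bound[of F] by (auto simp: good_def)
  have "good {x}" using \<open>x \<in> X\<close> by (simp add: good_def)
  moreover have "\<forall>F. good F \<longrightarrow> card F < Suc (nat k)" using card_le by fastforce
  ultimately obtain F where F: "good F" and max: "\<And>G. good G \<Longrightarrow> card G \<le> card F"
    using ex_has_greatest_nat[of good "{x}" card "Suc (nat k)"] by blast
  have "y \<in> D + F" if "y \<in> X" for y
  proof -
    have "\<exists>f\<in>F. y - f \<in> D"
    proof (cases "y \<in> F")
      case True
      then show ?thesis using zero by force
    next
      case False
      show ?thesis
      proof (rule ccontr)
        assume none: "\<not> (\<exists>f\<in>F. y - f \<in> D)"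
        then have "f - y \<notin> D" if "f \<in> F" for f
          using sym[of "y - f"] that by auto
        with none have "good (insert y F)"
          using F \<open>y \<in> X\<close> by (auto simp: good_def)
        from max[OF this] show False using False F by (simp add: good_def)
      qed
    qed
    then obtain f where "f \<in> F" "y - f \<in> D" by blast
    then show ?thesis using set_plus_intro[of "y - f" D f F] by simp
  qed
  then show ?thesis using F card_le[OF F] by (auto simp: good_def)
qed

theorem corollary5p4:
  fixes A B :: "int set" and \<alpha> \<beta> \<epsilon> :: real and k :: int
  assumes "upper_banach_density A = \<alpha>" and "\<alpha> > 0"
    and "upper_banach_density B = \<beta>" and "\<beta> > 0"
    and "0 \<le> \<epsilon>" and "\<epsilon> < \<alpha>\<^sup>2 * \<beta>\<^sup>2"
    and "k = \<lfloor>(\<alpha> * \<beta> - \<epsilon>) / (\<alpha>\<^sup>2 * \<beta>\<^sup>2 - \<epsilon>)\<rfloor>"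
  shows "(\<forall>X :: int set. infinite X \<longrightarrow> (\<forall>x\<in>X. \<exists>F. finite F \<and> F \<subseteq> X \<and> x \<in> F \<and> int (card F) \<le> k \<and>
            X \<subseteq> (Delta \<epsilon> A \<inter> Delta \<epsilon> B) + F)) \<and>
         (\<forall>h :: int. syndetic (set_quotient (Delta \<epsilon> A) h \<inter> set_quotient (Delta \<epsilon> B) h) \<and>
            lower_banach_density (set_quotient (Delta \<epsilon> A) h \<inter> set_quotient (Delta \<epsilon> B) h)
              \<ge> 1 / real_of_int k)"
proof -
  let ?D = "Delta \<epsilon> A \<inter> Delta \<epsilon> B"
  have le1: "\<alpha> \<le> 1" "\<beta> \<le> 1" using assms upper_banach_density_le_one by blast+
  have "\<alpha>\<^sup>2 * \<beta>\<^sup>2 \<le> \<alpha> * 1" "\<alpha>\<^sup>2 * \<beta>\<^sup>2 \<le> 1 * \<beta>"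
    using assms le1 by (intro mult_mono; simp add: power2_eq_square mult_left_le mult_le_one)+
  then have "0 \<in> ?D" using assms by (simp add: Delta_def)
  then have cover: "\<exists>F. finite F \<and> F \<subseteq> X \<and> x \<in> F \<and> int (card F) \<le> k \<and> X \<subseteq> ?D + F"
    if "x \<in> X" for X x
    using that small_overlap_card_le[of A \<alpha> B \<beta> \<epsilon>] assms
    by (intro maximal_family_covers) (auto simp: Delta_uminus)
  have "syndetic (set_quotient (Delta \<epsilon> A) h \<inter> set_quotient (Delta \<epsilon> B) h) \<and>
      lower_banach_density (set_quotient (Delta \<epsilon> A) h \<inter> set_quotient (Delta \<epsilon> B) h) \<ge> 1 / real_of_int k"
    for h
  proof -
    define S where "S = set_quotient (Delta \<epsilon> A) h \<inter> set_quotient (Delta \<epsilon> B) h"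
    obtain F where F: "finite F" "F \<subseteq> range ((*) h)" "h * 0 \<in> F" "int (card F) \<le> k"
      "range ((*) h) \<subseteq> ?D + F"
      using cover[of "h * 0" "range ((*) h)"] by blast
    \<comment> \<open>Injectivity is demanded on \<open>G\<close> only, so that \<open>h = 0\<close> is included: then \<open>G\<close> is a singleton.\<close>
    obtain G where G: "F = (*) h ` G" "inj_on ((*) h) G"
      using F(2) subset_image_inj[of F "(*) h" UNIV] by auto
    have finG: "finite G" and cardG: "card G = card F"
      using F(1) G by (auto simp: card_image finite_image_iff)
    have "UNIV = S + G"
    proof (rule UNIV_eq_I)
      fix z
      have "h * z \<in> ?D + F" using F(5) by blast
      then obtain d g where "d \<in> ?D" "g \<in> G" "h * z = d + h * g"
        using G(1) by (auto elim!: set_plus_elim)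
      then have "z - g \<in> S"
        by (simp add: S_def set_quotient_def right_diff_distrib)
      then show "z \<in> S + G" using set_plus_intro[of "z - g" S g G] \<open>g \<in> G\<close> by simp
    qed
    then have "lower_banach_density S \<ge> 1 / real (card G)"
      by (rule lower_banach_density_of_translates_cover[OF finG, OF sym])
    moreover have "0 < card F" using F by (auto simp: card_gt_0_iff)
    moreover from this have "1 / real_of_int k \<le> 1 / real (card G)" "0 < 1 / real_of_int k"
      using F(4) by (auto simp: cardG intro!: divide_left_mono mult_pos_pos)
    ultimately have "1 / real_of_int k \<le> lower_banach_density S" "0 < lower_banach_density S"
      by linarith+
    then show ?thesis
      unfolding S_def[symmetric] by (simp add: syndetic_of_lower_banach_density_pos)
  qed
  with cover show ?thesis by blast
qed

end
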